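(* Let $\Phi'\subseteq\Phi\subseteq BC_n$ be nested root systems, and suppose $\Phi'$ is a Levi subsystem of $\Phi$. Then: (a) if $\Phi=A_{n-1}$, $\Phi'$ is equivalent to a direct sum of (arbitrarily many) type-$A$ root systems; (b) if $\Phi=B_n$ (resp. $\Phi=C_n$, $\Phi=D_n$), $\Phi'$ is equivalent to a direct sum of arbitrarily many type-$A$ root systems, plus at most a single root system of type $B$ (resp. type $C$, type $D$).
   Context: Let $V=\mathbb{C}^n$ with canonical basis $(e_1,\dots,e_n)$, orthonormal for the scalar product. For a nonempty $I\subseteq\{1,\dots,n\}$ set $A_I=\{e_i-e_j : i\neq j\in I\}$, $D_I=A_I\cup\{\pm(e_i+e_j): i\ne j\in I\}$, $B_I=D_I\cup\{\pm e_i: i\in I\}$, $C_I=D_I\cup\{\pm 2e_i : i\in I\}$, $BC_I=B_I\cup C_I$. For $I=\{1,\dots,n\}$ these are denoted $A_{n-1},D_n,B_n,C_n,BC_n$. A root subsystem of $BC_n$ is a subset stable under the orthogonal reflections defined by its elements; "nested root systems" means both are root subsystems. $\Phi'$ is a Levi subsystem of $\Phi$ if it is a root subsystem and $\mathrm{span}_{\mathbb{C}}(\Phi')\cap\Phi=\Phi'$. Two root subsystems of $BC_n$ are equivalent if they lie in the same orbit of the Weyl group $W(BC_n)$. The direct sums in the statement are unions $\bigcup_kX^{(k)}_{I_k}$ over the parts of a partition $\{1,\dots,n\}=\bigsqcup_kI_k$, where each $X^{(k)}_{I_k}$ is $A_{I_k}$ (empty if $|I_k|=1$), $B_{I_k}$,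 $C_{I_k}$ or $D_{I_k}$ as allowed; type $D$ includes $D_I$ with $|I|=2$. *)

theory Defs
  imports "HOL-Analysis.Analysis" "HOL-Algebra.Bij" "HOL-Algebra.Generated_Groups"
begin

text \<open>
  The space \<open>V = \<complex>\<^sup>n\<close> is \<^typ>\<open>complex ^ 'n\<close>, where the finite (nonempty) index type \<open>'n\<close>
  replaces \<open>{1, \<dots>, n}\<close>. The library's inner product on this type is real-valued, and its unqualified
  \<open>span\<close> is the real span. Hence the complex scalar product is defined here, and complex
  spans are taken with \<open>vec.span\<close>.
\<close>

definition cinner :: "complex ^ 'n \<Rightarrow> complex ^ 'n \<Rightarrow> complex" where
  "cinner x y = (\<Sum>i\<in>UNIV. x $ i * cnj (y $ i))"

definition reflection :: "complex ^ 'n \<Rightarrow> complex ^ 'n \<Rightarrow> complex ^ 'n" where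
  "reflection \<alpha> v = v - (2 * cinner v \<alpha> / cinner \<alpha> \<alpha>) *s \<alpha>"

definition unit_vec :: "'n \<Rightarrow> complex ^ 'n" where
  "unit_vec i = axis i 1"

definition A_roots :: "'n set \<Rightarrow> (complex ^ 'n) set" where
  "A_roots I = {unit_vec i - unit_vec j | i j. i \<in> I \<and> j \<in> I \<and> i \<noteq> j}"

definition D_roots :: "'n set \<Rightarrow> (complex ^ 'n) set" where
  "D_roots I = A_roots I \<union> {unit_vec i + unit_vec j | i j. i \<in> I \<and> j \<in> I \<and> i \<noteq> j}
                         \<union> {- (unit_vec i + unit_vec j) | i j. i \<in> I \<and> j \<in> I \<and> i \<noteq> j}"

definition B_roots :: "'n set \<Rightarrow> (complex ^ 'n) set" where
  "B_roots I = D_roots I \<union> {unit_vec i | i. i \<in> I} \<union> {- unit_vec i | i. i \<in> I}"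

definition C_roots :: "'n set \<Rightarrow> (complex ^ 'n) set" where
  "C_roots I = D_roots I \<union> {2 *s unit_vec i | i. i \<in> I} \<union> {- (2 *s unit_vec i) | i. i \<in> I}"

definition BC_roots :: "'n set \<Rightarrow> (complex ^ 'n) set" where
  "BC_roots I = B_roots I \<union> C_roots I"

definition root_subsystem :: "(complex ^ 'n) set \<Rightarrow> bool" where
  "root_subsystem \<Psi> \<longleftrightarrow> \<Psi> \<subseteq> BC_roots UNIV \<and> (\<forall>\<alpha>\<in>\<Psi>. reflection \<alpha> ` \<Psi> \<subseteq> \<Psi>)"

definition levi_subsystem :: "(complex ^ 'n) set \<Rightarrow> (complex ^ 'n) set \<Rightarrow> bool" where
  "levi_subsystem \<Psi> \<Phi> \<longleftrightarrow> root_subsystem \<Psi> \<and> vec.span \<Psi> \<inter> \<Phi> = \<Psi>"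

definition weyl_group_BC :: "(complex ^ 'n \<Rightarrow> complex ^ 'n) set" where
  "weyl_group_BC = generate (BijGroup UNIV) (reflection ` BC_roots UNIV)"

definition weyl_equivalent :: "(complex ^ 'n) set \<Rightarrow> (complex ^ 'n) set \<Rightarrow> bool" where
  "weyl_equivalent \<Psi>\<^sub>1 \<Psi>\<^sub>2 \<longleftrightarrow> (\<exists>w\<in>weyl_group_BC. w ` \<Psi>\<^sub>1 = \<Psi>\<^sub>2)"

datatype root_type = Type_A | Type_B | Type_C | Type_D

fun roots_of_type :: "root_type \<Rightarrow> 'n set \<Rightarrow> (complex ^ 'n) set" where
  "roots_of_type Type_A I = A_roots I"
| "roots_of_type Type_B I = B_roots I"
| "roots_of_type Type_C I = C_roots I"
| "roots_of_type Type_D I = D_roots I"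

text \<open>
  In the following, \<open>P\<close> is a partition of the index set and \<open>T\<close> gives the type of each part;
  parts \<open>{i}\<close> of type \<open>A\<close> contribute no roots.
\<close>

definition direct_sum :: "'n set set \<Rightarrow> ('n set \<Rightarrow> root_type) \<Rightarrow> (complex ^ 'n) set" where
  "direct_sum P T = (\<Union>I\<in>P. roots_of_type (T I) I)"

end

theory Submission
  imports Defs
begin

text \<open>
  A Levi subsystem is the trace \<open>W \<inter> \<Phi>\<close> of the subspace \<open>W\<close> that it spans, and the trace of any
  subspace \<open>W\<close> on a classical root system has the asserted shape. In types \<open>B\<close>, \<open>C\<close> and \<open>D\<close>,
  call \<open>i\<close> and \<open>j\<close> linked if \<open>e\<^sub>i - \<sigma> e\<^sub>j \<in> W\<close> for some sign \<open>\<sigma>\<close>, so that a root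
  \<open>\<plusminus>e\<^sub>i \<plusminus> e\<^sub>j\<close> in \<open>W\<close> always joins linked indices. Multiplying signs along a chain shows that this is an
  equivalence relation, and its classes are the parts of the partition. The indices with \<open>e\<^sub>i \<in> W\<close>
  form at most one class \<open>Z\<close>, since \<open>e\<^sub>i \<in> W\<close> propagates along links while any two
  such indices are linked. On \<open>Z\<close> every root of \<open>\<Phi>\<close> lies in \<open>W\<close>, which gives the single part of
  type \<open>B\<close>, \<open>C\<close> or \<open>D\<close>.

  On any other class the sign \<open>\<sigma>\<close> of a link is unique, because both signs together would give
  \<open>2 e\<^sub>i \<in> W\<close>. Comparing each index with a representative of its class gives signs \<open>\<epsilon> i\<close> such that
  \<open>\<epsilon> i e\<^sub>i - \<epsilon> j e\<^sub>j \<in> W\<close> for all linked \<open>i\<close>, \<open>j\<close>, and by uniqueness these are, up to a global sign,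
  the only roots in \<open>W\<close> on a class other than \<open>Z\<close>. The diagonal sign change \<open>e\<^sub>i \<mapsto> \<epsilon> i e\<^sub>i\<close>, which
  is a product of reflections in the \<open>e\<^sub>i\<close>, therefore turns them into \<open>A\<^sub>I\<close>.
  In type \<open>A\<close> only the roots \<open>e\<^sub>i - e\<^sub>j\<close> occur, so the relation \<open>e\<^sub>i - e\<^sub>j \<in> W\<close> gives the
  partition and no sign change is needed.
\<close>

section \<open>Sign changes in the Weyl group\<close>

definition sign_change :: "('n \<Rightarrow> complex) \<Rightarrow> complex ^ 'n \<Rightarrow> complex ^ 'n" where
  "sign_change \<epsilon> v = (\<chi> i. \<epsilon> i * v $ i)"

lemma sign_change_unit_vec: "sign_change \<epsilon> (c *s unit_vec i) = (\<epsilon> i * c) *s unit_vec i"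
  by (auto simp: sign_change_def unit_vec_def axis_def vec_eq_iff)

lemma sign_change_add: "sign_change \<epsilon> (u + v) = sign_change \<epsilon> u + sign_change \<epsilon> v"
  by (simp add: sign_change_def vec_eq_iff ring_distribs)

lemma sign_change_involution:
  assumes "\<And>i. \<epsilon> i \<in> {1, -1}"
  shows "sign_change \<epsilon> (sign_change \<epsilon> v) = v"
proof -
  have "\<epsilon> i * \<epsilon> i = 1" for i
    using assms[of i] by auto
  then show ?thesis
    by (simp add: sign_change_def vec_eq_iff mult.assoc[symmetric])
qed

lemma sign_change_in_Bij:
  assumes "\<And>i. \<epsilon> i \<in> {1, -1}"
  shows "sign_change \<epsilon> \<in> Bij UNIV"
proof -
  have "sign_change \<epsilon> \<circ> sign_change \<epsilon> = id"
    using sign_change_involution[of \<epsilon>] assms by auto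
  then have "bij (sign_change \<epsilon>)"
    using o_bij by blast
  then show ?thesis
    by (simp add: Bij_def)
qed

lemma reflection_unit_vec:
  "reflection (unit_vec k) = sign_change (\<lambda>i. if i = k then -1 else 1)"
proof
  fix v
  have "cinner u (unit_vec k) = u $ k" for u
    by (simp add: cinner_def unit_vec_def axis_def if_distrib[of cnj] if_distrib[of "(*) _"]
        cong: if_cong)
  then show "reflection (unit_vec k) v = sign_change (\<lambda>i. if i = k then -1 else 1) v"
    by (auto simp: reflection_def sign_change_def vec_eq_iff unit_vec_def axis_def)
qed

lemma id_in_weyl_group: "id \<in> weyl_group_BC"
proof -
  have "\<one>\<^bsub>BijGroup UNIV\<^esub> = (id :: complex ^ 'n \<Rightarrow> complex ^ 'n)"
    by (auto simp: BijGroup_def restrict_def)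
  then show ?thesis
    unfolding weyl_group_BC_def by (metis generate.one)
qed

text \<open>
  The reflection in \<open>e\<^sub>k\<close> flips coordinate \<open>k\<close> alone, so the sign changes are reached by flipping
  the negative coordinates one at a time.
\<close>

lemma sign_change_in_weyl_group:
  fixes \<epsilon> :: "'n::finite \<Rightarrow> complex"
  assumes "\<And>i. \<epsilon> i \<in> {1, -1}"
  shows "sign_change \<epsilon> \<in> weyl_group_BC"
proof -
  define f :: "'n set \<Rightarrow> 'n \<Rightarrow> complex" where "f S = (\<lambda>i. if i \<in> S then -1 else 1)" for S
  have f_Bij: "sign_change (f S) \<in> Bij UNIV" for S
    by (rule sign_change_in_Bij) (simp add: f_def)
  have "sign_change (f S) \<in> weyl_group_BC" if "finite S" for S
    using that
  proof (induction S)
    case empty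
    have "sign_change (f {}) = id"
      by (auto simp: f_def sign_change_def vec_eq_iff)
    then show ?case
      using id_in_weyl_group by metis
  next
    case (insert k S)
    have "sign_change (f (insert k S)) v = sign_change (f {k}) (sign_change (f S) v)" for v
      using insert.hyps by (auto simp: f_def sign_change_def vec_eq_iff)
    then have split: "sign_change (f (insert k S))
        = sign_change (f {k}) \<otimes>\<^bsub>BijGroup UNIV\<^esub> sign_change (f S)"
      using f_Bij by (auto simp: BijGroup_def compose_def)
    have "sign_change (f {k}) = reflection (unit_vec k)"
      by (simp add: reflection_unit_vec f_def)
    then have "sign_change (f {k}) \<in> weyl_group_BC"
      unfolding weyl_group_BC_def
      by (intro generate.incl) (auto simp: BC_roots_def B_roots_def)
    then show ?case
      using insert.IH unfolding split weyl_group_BC_def by (rule generate.eng)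
  qed
  moreover have "\<epsilon> = f {i. \<epsilon> i = -1}"
    using assms by (fastforce simp: f_def)
  ultimately show ?thesis
    by (metis finite)
qed

section \<open>Signed descriptions of the root systems\<close>

lemma D_roots_signed:
  "D_roots I = {s *s unit_vec i + t *s unit_vec j | s t i j.
     s \<in> {1, -1} \<and> t \<in> {1, -1} \<and> i \<in> I \<and> j \<in> I \<and> i \<noteq> j}" (is "_ = ?S")
proof
  show "D_roots I \<subseteq> ?S"
  proof
    fix v assume "v \<in> D_roots I"
    then obtain i j where "i \<in> I" "j \<in> I" "i \<noteq> j"
      and "v = 1 *s unit_vec i + (-1) *s unit_vec j \<or> v = 1 *s unit_vec i + 1 *s unit_vec j
        \<or> v = (-1) *s unit_vec i + (-1) *s unit_vec j"
      by (auto simp: D_roots_def A_roots_def)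
    then show "v \<in> ?S"
      by blast
  qed
  show "?S \<subseteq> D_roots I"
    by (auto simp: D_roots_def A_roots_def) metis+
qed

text \<open>
  Types \<open>B\<close>, \<open>C\<close> and \<open>D\<close> differ only in the multiples of the basis vectors that are roots. Recording
  these multiples as a set \<open>S\<close> of scalars lets the three types share one argument.
\<close>

lemma roots_of_type_not_A:
  assumes "X \<noteq> Type_A"
  obtains S :: "complex set" where "0 \<notin> S" and "\<And>c. c \<in> S \<Longrightarrow> -c \<in> S"
    and "\<And>I :: 'n::finite set. roots_of_type X I = D_roots I \<union> {c *s unit_vec i | c i. c \<in> S \<and> i \<in> I}"
proof -
  have minus: "- (c *s v) = (- c) *s v" for c and v :: "complex ^ 'n"
    by (simp add: vec_eq_iff)
  have split: "{c *s unit_vec i | c i. c \<in> {a, - a} \<and> i \<in> I}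
      = {a *s unit_vec i | i. i \<in> I} \<union> {- (a *s unit_vec i) | i. i \<in> I}"
    for a and I :: "'n set"
    unfolding minus by blast
  show ?thesis
  proof (cases X)
    case Type_B
    show ?thesis
      by (rule that[of "{1, -1}"]) (auto simp: Type_B B_roots_def split[of 1, simplified])
  next
    case Type_C
    show ?thesis
      by (rule that[of "{2, -2}"]) (auto simp: Type_C C_roots_def split[of 2, simplified])
  next
    case Type_D
    show ?thesis
      by (rule that[of "{}"]) (auto simp: Type_D)
  qed (use assms in simp)
qed

section \<open>Traces of subspaces on classical root systems\<close>

lemma trace_on_type_A:
  fixes W :: "(complex ^ 'n) set"
  assumes W: "vec.subspace W"
  shows "\<exists>P T. partition_on UNIV P \<and> (\<forall>I\<in>P. T I = Type_A) \<and>
           weyl_equivalent (W \<inter> A_roots UNIV) (direct_sum P T)"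
proof -
  define R where "R = {(i, j). unit_vec i - unit_vec j \<in> W}"
  have R: "equiv UNIV R"
  proof (rule equivI)
    show "refl_on UNIV R"
      using vec.subspace_0[OF W] by (auto simp: R_def refl_on_def)
    show "sym R"
      using vec.subspace_neg[OF W] by (force simp: R_def sym_def)
    show "trans R"
      using vec.subspace_add[OF W] by (force simp: R_def trans_def)
  qed simp
  have "W \<inter> A_roots UNIV = direct_sum (UNIV // R) (\<lambda>_. Type_A)" (is "?L = ?D")
  proof
    show "?L \<subseteq> ?D"
    proof
      fix v assume "v \<in> ?L"
      then obtain i j where v: "v = unit_vec i - unit_vec j" and "i \<noteq> j" and "(i, j) \<in> R"
        by (auto simp: A_roots_def R_def)
      moreover have "i \<in> R `` {i}"
        using equiv_class_self[OF R] by simp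
      ultimately have "v \<in> A_roots (R `` {i})"
        by (auto simp: A_roots_def)
      then show "v \<in> ?D"
        by (auto simp: direct_sum_def quotient_def)
    qed
    show "?D \<subseteq> ?L"
    proof
      fix v assume "v \<in> ?D"
      then obtain I i j where "I \<in> UNIV // R" "i \<in> I" "j \<in> I" "i \<noteq> j"
        and v: "v = unit_vec i - unit_vec j"
        by (auto simp: direct_sum_def A_roots_def)
      then have "(i, j) \<in> R"
        using quotient_eq_iff[OF R] by blast
      then show "v \<in> ?L"
        using \<open>i \<noteq> j\<close> by (auto simp: v R_def A_roots_def)
    qed
  qed
  then have "weyl_equivalent (W \<inter> A_roots UNIV) (direct_sum (UNIV // R) (\<lambda>_. Type_A))"
    unfolding weyl_equivalent_def by (intro bexI[OF _ id_in_weyl_group]) simp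
  then show ?thesis
    using partition_on_quotient[OF R]
    by (intro exI[of _ "UNIV // R"] exI[of _ "\<lambda>_. Type_A"]) simp
qed

text \<open>
  The sign change is chosen by aligning each index with a representative of its class. It preserves
  the root system on every set of indices, hence also the part \<open>Z\<close>, while outside \<open>Z\<close> it makes the
  two coefficients of each root in \<open>W\<close> opposite, which is what being of type \<open>A\<close> means.
\<close>

lemma trace_on_type_BCD:
  fixes W :: "(complex ^ 'n) set"
  assumes W: "vec.subspace W" and X: "X \<noteq> Type_A"
  shows "\<exists>P T. partition_on UNIV P \<and> (\<forall>I\<in>P. T I \<in> {Type_A, X}) \<and>
           card {I \<in> P. T I = X} \<le> 1 \<and>
           weyl_equivalent (W \<inter> roots_of_type X UNIV) (direct_sum P T)"
proof -
  obtain S where S0: "0 \<notin> S" and Sneg: "\<And>c. c \<in> S \<Longrightarrow> -c \<in> S"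
    and roots: "\<And>I :: 'n set. roots_of_type X I
      = D_roots I \<union> {c *s unit_vec i | c i. c \<in> S \<and> i \<in> I}"
    using roots_of_type_not_A[OF X] by blast
  have scale: "c *s v \<in> W" if "v \<in> W" for c v
    using vec.subspace_scale[OF W that] .
  have unscale: "v \<in> W" if "c *s v \<in> W" "c \<noteq> 0" for c v
    using scale[OF that(1), of "inverse c"] that(2) by (simp add: vector_smult_assoc)
  note add = vec.subspace_add[OF W] and diff = vec.subspace_diff[OF W]

  define Z where "Z = {i. unit_vec i \<in> W}"
  define R where "R = {(i, j). \<exists>\<sigma>\<in>{1, -1}. unit_vec i - \<sigma> *s unit_vec j \<in> W}"
  have R: "equiv UNIV R"
  proof (rule equivI)
    show "refl_on UNIV R"
      using vec.subspace_0[OF W] by (auto simp: R_def refl_on_def)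
    have "unit_vec j - \<sigma> *s unit_vec i \<in> W"
      if "\<sigma> \<in> {1, -1}" "unit_vec i - \<sigma> *s unit_vec j \<in> W" for \<sigma> i j
      using scale[OF that(2), of "- \<sigma>"] that(1)
      by (auto simp: vector_smult_assoc vector_ssub_ldistrib)
    then show "sym R"
      unfolding R_def sym_def by blast
    show "trans R"
    proof (rule transI)
      fix i j k assume "(i, j) \<in> R" "(j, k) \<in> R"
      then obtain \<sigma> \<tau> where st: "\<sigma> \<in> {1, -1}" "\<tau> \<in> {1, -1}"
        and ij: "unit_vec i - \<sigma> *s unit_vec j \<in> W" and jk: "unit_vec j - \<tau> *s unit_vec k \<in> W"
        unfolding R_def by blast
      have "unit_vec i - (\<sigma> * \<tau>) *s unit_vec k \<in> W"
        using add[OF ij scale[OF jk, of \<sigma>]]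
        by (simp add: vector_smult_assoc vector_ssub_ldistrib)
      moreover have "\<sigma> * \<tau> \<in> {1, -1}"
        using st by auto
      ultimately show "(i, k) \<in> R"
        unfolding R_def by blast
    qed
  qed simp
  have linked_Z: "j \<in> Z" if "(i, j) \<in> R" "i \<in> Z" for i j
  proof -
    from that obtain \<sigma> where \<sigma>: "\<sigma> \<in> {1, -1}" and ij: "unit_vec i - \<sigma> *s unit_vec j \<in> W"
      and i: "unit_vec i \<in> W"
      unfolding R_def Z_def by blast
    from diff[OF i ij] have "\<sigma> *s unit_vec j \<in> W"
      by simp
    moreover have "\<sigma> \<noteq> 0"
      using \<sigma> by auto
    ultimately show ?thesis
      using unscale by (simp add: Z_def)
  qed
  have Z_linked: "(i, j) \<in> R" if "i \<in> Z" "j \<in> Z" for i j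
    using that diff[of "unit_vec i" "unit_vec j"] by (auto simp: Z_def R_def)
  have Z_class: "R `` {i} = Z" if "i \<in> Z" for i
    using that linked_Z Z_linked by blast

  define rep where "rep i = (SOME j. j \<in> R `` {i})" for i
  define \<epsilon> :: "'n \<Rightarrow> complex" where
    "\<epsilon> i = (if unit_vec i - unit_vec (rep i) \<in> W then 1 else -1)" for i
  have \<epsilon>: "\<epsilon> i \<in> {1, -1}" for i
    by (simp add: \<epsilon>_def)
  have rep: "unit_vec i - \<epsilon> i *s unit_vec (rep i) \<in> W" for i
  proof -
    have "i \<in> R `` {i}"
      using equiv_class_self[OF R] by simp
    then have "rep i \<in> R `` {i}"
      unfolding rep_def by (rule someI)
    then show ?thesis
      by (auto simp: \<epsilon>_def R_def)
  qed
  have aligned: "\<epsilon> i *s unit_vec i - \<epsilon> j *s unit_vec j \<in> W" if "(i, j) \<in> R" for i j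
  proof -
    have "rep i = rep j"
      unfolding rep_def using equiv_class_eq[OF R that] by simp
    \<comment> \<open>Since \<open>\<epsilon> k * \<epsilon> k = 1\<close>, the vector \<open>\<epsilon> k e\<^sub>k\<close> is congruent modulo \<open>W\<close> to the
      basis vector of the representative.\<close>
    moreover have "\<epsilon> k *s unit_vec k - unit_vec (rep k) \<in> W" for k
      using scale[OF rep[of k], of "\<epsilon> k"] \<epsilon>[of k]
      by (auto simp: vector_smult_assoc vector_ssub_ldistrib)
    from diff[OF this[of i] this[of j]] have
      "\<epsilon> i *s unit_vec i - \<epsilon> j *s unit_vec j + (unit_vec (rep j) - unit_vec (rep i)) \<in> W"
      by (simp add: algebra_simps)
    ultimately show ?thesis
      by simp
  qed

  define P where "P = UNIV // R"
  define T where "T I = (if I = Z then X else Type_A)" for I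
  let ?w = "sign_change \<epsilon>"
  have w_D: "?w (s *s unit_vec i + t *s unit_vec j)
      = (\<epsilon> i * s) *s unit_vec i + (\<epsilon> j * t) *s unit_vec j" for s t i j
    by (simp add: sign_change_add sign_change_unit_vec)
  have sign_mult: "\<epsilon> i * s \<in> {1, -1}" if "s \<in> {1, -1}" for i s
    using \<epsilon>[of i] that by auto
  have S_mult: "\<epsilon> i * c \<in> S" if "c \<in> S" for i c
    using \<epsilon>[of i] that Sneg by auto
  have w_roots: "?w v \<in> roots_of_type X I" if v: "v \<in> roots_of_type X I" for v and I :: "'n set"
    using v unfolding roots
  proof
    assume "v \<in> D_roots I"
    then obtain s t i j where "v = s *s unit_vec i + t *s unit_vec j"
      "s \<in> {1, -1}" "t \<in> {1, -1}" "i \<in> I" "j \<in> I" "i \<noteq> j"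
      unfolding D_roots_signed by blast
    then have "?w v \<in> D_roots I"
      unfolding D_roots_signed using w_D sign_mult by blast
    then show "?w v \<in> D_roots I \<union> {c *s unit_vec i | c i. c \<in> S \<and> i \<in> I}" ..
  next
    assume "v \<in> {c *s unit_vec i | c i. c \<in> S \<and> i \<in> I}"
    then have "?w v \<in> {c *s unit_vec i | c i. c \<in> S \<and> i \<in> I}"
      using S_mult sign_change_unit_vec by blast
    then show "?w v \<in> D_roots I \<union> {c *s unit_vec i | c i. c \<in> S \<and> i \<in> I}" ..
  qed
  have roots_mono: "roots_of_type X I \<subseteq> roots_of_type X UNIV" for I :: "'n set"
    unfolding roots D_roots_signed by blast
  have roots_Z: "roots_of_type X Z \<subseteq> W"
    unfolding roots D_roots_signed Z_def using add scale by blast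

  have forward: "?w v \<in> direct_sum P T" if v: "v \<in> W \<inter> roots_of_type X UNIV" for v
  proof -
    have in_Z: "?w v \<in> direct_sum P T" if "i \<in> Z" "v \<in> roots_of_type X Z" for i
    proof -
      have "Z \<in> P"
        using Z_class[OF \<open>i \<in> Z\<close>] unfolding P_def quotient_def by blast
      moreover have "?w v \<in> roots_of_type (T Z) Z"
        using w_roots[OF that(2)] by (simp add: T_def)
      ultimately show ?thesis
        unfolding direct_sum_def by (rule UN_I)
    qed
    from v consider
        (D) s t i j where "v = s *s unit_vec i + t *s unit_vec j"
          "s \<in> {1, -1}" "t \<in> {1, -1}" "i \<noteq> j"
      | (S) c i where "v = c *s unit_vec i" "c \<in> S"
      unfolding roots D_roots_signed by blast
    then show ?thesis
    proof cases
      case S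
      then have "i \<in> Z"
        using v unscale S0 by (auto simp: Z_def)
      with S show ?thesis
        by (intro in_Z[of i]) (auto simp: roots)
    next
      case D
      have st: "unit_vec i - (- s * t) *s unit_vec j \<in> W"
        using scale[of v s] v D by (auto simp: vector_smult_assoc vector_add_ldistrib)
      moreover have "- s * t \<in> {1, -1}"
        using D by auto
      ultimately have ij: "(i, j) \<in> R"
        unfolding R_def by blast
      show ?thesis
      proof (cases "i \<in> Z")
        case True
        then have "j \<in> Z"
          using linked_Z ij by blast
        with True D have "v \<in> roots_of_type X Z"
          unfolding roots D_roots_signed by blast
        with True show ?thesis
          by (rule in_Z)
      next
        case False
        \<comment> \<open>If the two signs of \<open>?w v\<close> agreed, adding \<open>v\<close> to a signed copy of the
          aligned vector would give a nonzero multiple of \<open>e\<^sub>i\<close> in \<open>W\<close>.\<close>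
        have "\<epsilon> i * s \<noteq> \<epsilon> j * t"
        proof
          assume eq: "\<epsilon> i * s = \<epsilon> j * t"
          have "v + (\<epsilon> i * s) *s (\<epsilon> i *s unit_vec i - \<epsilon> j *s unit_vec j) \<in> W"
            using v aligned[OF ij] add scale by blast
          also have "v + (\<epsilon> i * s) *s (\<epsilon> i *s unit_vec i - \<epsilon> j *s unit_vec j)
              = (s + (\<epsilon> i * s) * \<epsilon> i) *s unit_vec i + (t - (\<epsilon> i * s) * \<epsilon> j) *s unit_vec j"
            unfolding D(1) by (simp add: vec_eq_iff algebra_simps)
          also have "t - (\<epsilon> i * s) * \<epsilon> j = 0"
            unfolding eq using \<epsilon>[of j] by auto
          also have "s + (\<epsilon> i * s) * \<epsilon> i = 2 * s"
            using \<epsilon>[of i] by auto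
          finally have "(2 * s) *s unit_vec i \<in> W"
            by simp
          moreover have "2 * s \<noteq> 0"
            using D(2) by auto
          ultimately have "unit_vec i \<in> W"
            using unscale by blast
          with False show False
            by (simp add: Z_def)
        qed
        then have opposite: "\<epsilon> i * s = 1 \<and> \<epsilon> j * t = -1 \<or> \<epsilon> i * s = -1 \<and> \<epsilon> j * t = 1"
          using sign_mult[OF D(2), of i] sign_mult[OF D(3), of j] by auto
        have i: "i \<in> R `` {i}"
          using equiv_class_self[OF R] by simp
        have "?w v \<in> A_roots (R `` {i})"
          using opposite
        proof
          assume "\<epsilon> i * s = 1 \<and> \<epsilon> j * t = -1"
          then have "?w v = unit_vec i - unit_vec j"
            by (simp add: D(1) w_D)
          then show ?thesis
            using i ij D(4) unfolding A_roots_def by blast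
        next
          assume "\<epsilon> i * s = -1 \<and> \<epsilon> j * t = 1"
          then have "?w v = unit_vec j - unit_vec i"
            by (simp add: D(1) w_D)
          then show ?thesis
            using i ij D(4) unfolding A_roots_def by blast
        qed
        moreover have "R `` {i} \<noteq> Z"
          using i False by blast
        ultimately have "?w v \<in> roots_of_type (T (R `` {i})) (R `` {i})"
          by (simp add: T_def)
        moreover have "R `` {i} \<in> P"
          unfolding P_def by (simp add: quotientI)
        ultimately show ?thesis
          unfolding direct_sum_def by blast
      qed
    qed
  qed

  have backward: "?w v \<in> W \<inter> roots_of_type X UNIV" if "v \<in> direct_sum P T" for v
  proof -
    from that obtain I where I: "I \<in> P" and v: "v \<in> roots_of_type (T I) I"
      by (auto simp: direct_sum_def)
    show ?thesis
    proof (cases "I = Z")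
      case True
      then have "?w v \<in> roots_of_type X Z"
        using v w_roots by (simp add: T_def)
      then show ?thesis
        using roots_Z roots_mono by blast
    next
      case False
      then obtain i j where ij: "i \<in> I" "j \<in> I" "i \<noteq> j" "v = unit_vec i - unit_vec j"
        using v by (auto simp: T_def A_roots_def)
      then have "(i, j) \<in> R"
        using I quotient_eq_iff[OF R] unfolding P_def by blast
      then have "?w v \<in> W"
        using aligned w_D[of 1 i "-1" j] by (simp add: ij(4))
      moreover have "v \<in> roots_of_type X UNIV"
        using ij unfolding roots D_roots_def A_roots_def by blast
      ultimately show ?thesis
        using w_roots by blast
    qed
  qed

  have "?w ` (W \<inter> roots_of_type X UNIV) = direct_sum P T"
  proof
    show "?w ` (W \<inter> roots_of_type X UNIV) \<subseteq> direct_sum P T"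
      using forward by blast
    show "direct_sum P T \<subseteq> ?w ` (W \<inter> roots_of_type X UNIV)"
    proof
      fix v assume "v \<in> direct_sum P T"
      then have "?w (?w v) \<in> ?w ` (W \<inter> roots_of_type X UNIV)"
        using backward by (intro imageI)
      then show "v \<in> ?w ` (W \<inter> roots_of_type X UNIV)"
        unfolding sign_change_involution[OF \<epsilon>] .
    qed
  qed
  then have "weyl_equivalent (W \<inter> roots_of_type X UNIV) (direct_sum P T)"
    unfolding weyl_equivalent_def by (rule bexI[where x = "?w"]) (rule sign_change_in_weyl_group[OF \<epsilon>])
  moreover have "partition_on UNIV P"
    unfolding P_def by (rule partition_on_quotient[OF R])
  moreover have "{I \<in> P. T I = X} \<subseteq> {Z}"
    using X by (auto simp: T_def)
  then have "card {I \<in> P. T I = X} \<le> 1"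
    using card_mono[of "{Z}" "{I \<in> P. T I = X}"] by simp
  moreover have "\<forall>I\<in>P. T I \<in> {Type_A, X}"
    by (simp add: T_def)
  ultimately show ?thesis
    by blast
qed

section \<open>Levi subsystems\<close>

theorem corollary9p4p1:
  fixes \<Phi> \<Phi>' :: "(complex ^ 'n) set"
  assumes "root_subsystem \<Phi>" and "root_subsystem \<Phi>'"
    and "\<Phi>' \<subseteq> \<Phi>" and "\<Phi> \<subseteq> BC_roots UNIV"
    and "levi_subsystem \<Phi>' \<Phi>"
  shows "(\<Phi> = A_roots UNIV \<longrightarrow>
            (\<exists>P T. partition_on UNIV P \<and> (\<forall>I\<in>P. T I = Type_A) \<and>
                   weyl_equivalent \<Phi>' (direct_sum P T))) \<and>
         (\<forall>X\<in>{Type_B, Type_C, Type_D}. \<Phi> = roots_of_type X UNIV \<longrightarrow>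
            (\<exists>P T. partition_on UNIV P \<and> (\<forall>I\<in>P. T I \<in> {Type_A, X}) \<and>
                   card {I \<in> P. T I = X} \<le> 1 \<and>
                   weyl_equivalent \<Phi>' (direct_sum P T)))"
proof -
  have trace: "vec.span \<Phi>' \<inter> \<Phi> = \<Phi>'"
    using assms(5) by (simp add: levi_subsystem_def)
  have W: "vec.subspace (vec.span \<Phi>')"
    by (rule vec.subspace_span)
  show ?thesis
  proof (intro conjI impI ballI)
    assume A: "\<Phi> = A_roots UNIV"
    show "\<exists>P T. partition_on UNIV P \<and> (\<forall>I\<in>P. T I = Type_A) \<and>
            weyl_equivalent \<Phi>' (direct_sum P T)"
      using trace_on_type_A[OF W] unfolding trace[unfolded A] .
  next
    fix X assume "X \<in> {Type_B, Type_C, Type_D}" and X: "\<Phi> = roots_of_type X UNIV"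
    then have "X \<noteq> Type_A"
      by auto
    then show "\<exists>P T. partition_on UNIV P \<and> (\<forall>I\<in>P. T I \<in> {Type_A, X}) \<and>
            card {I \<in> P. T I = X} \<le> 1 \<and> weyl_equivalent \<Phi>' (direct_sum P T)"
      using trace_on_type_BCD[OF W, of X] unfolding trace[unfolded X] by blast
  qed
qed

end
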